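(* Let $m\ge 2$, $s\ge2$, $2\le w<r<\overline{n}=2m$, $n=s\overline{n}$, and let $c$ be a primitive element of $\mathbf{F}_q$, where $q>sm(w+2)$ if $w=2$ and $q>sm(w+1)$ if $w\in[3:r)$. For $i\in[0:m)$ and $u\in[0:w)$ let $$\lambda_{i,u}=\begin{cases}c^{i(w+2)+u},&w=2,\\ c^{i(w+1)+u},&w\in[3:r),\end{cases}\qquad \lambda_{i+m,u}=\begin{cases}c^{i(w+2)+w+u},&w=2,\\ c^{i(w+1)+w},&w\in[3:r),\ u=0,\\ c^{i(w+1)+(u\%(w-1))+1},&w\in[3:r),\ u\ge1.\end{cases}$$ Set, for $i\in[0:n)$, $$x_i=\begin{cases}c^{\lfloor i/\overline{n}\rfloor m(w+2)},&w=2,\\ c^{\lfloor i/\overline{n}\rfloor m(w+1)},&w\in[3:r).\end{cases}$$ Then, with $\bar i=i\%\overline{n}$ and $\bar j=j\%\overline{n}$, all of the following hold: i) $x_i\lambda_{\bar i,u}\ne x_j\lambda_{\bar j,u'}$ for $u,u'\in[0:w)$ and $i,j\in[0:n)$ with $i\not\equiv j\bmod m$; ii) $x_i\lambda_{\bar i,u}\ne x_j\lambda_{\bar j,u}$ for $u\in[0:w)$ and $i,j\in[0:n)$ with $i\ne j$ and $i\equiv j\bmod m$; iii) $\lambda_{\bar i,u}\ne\lambda_{\bar i,u'}$ for $u,u'\in[0:w)$ with $u\ne u'$ and $\bar i\in[0:\overline{n})$; iv) $x_i\lambda_{\bar i,0}\ne x_j\lambda_{\bar j,u}$ for $u\in[1:w)$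 and $i,j\in[0:n)$ with $i\equiv j\bmod m$ and $i\not\equiv j\bmod\overline{n}$.
   Context: $[a:b)=\{a,a+1,\dots,b-1\}$; $\%$ is the modulo operation. These four conditions are the sufficient conditions for the paper's code $\mathcal{C}_1$ (built from the elements $x_i$, $\lambda_{i,u}$) to be an MDS array code with its asserted repair property. *)

theory Defs
  imports "HOL-Number_Theory.Number_Theory" "HOL-Library.Cardinality"
begin

definition primitive_element :: "'a::{field,finite} \<Rightarrow> bool" where
  "primitive_element c \<longleftrightarrow> range (\<lambda>k::nat. c ^ k) = UNIV - {0}"

(* The first index ranges over [0:2m); the second half, lambda_{i+m,u} for i in [0:m),
   is the branch i >= m, so that the exponent there uses i - m.
   The branch for w other than 2 is only meant for w >= 3. *)
definition lam :: "nat \<Rightarrow> nat \<Rightarrow> 'a::field \<Rightarrow> nat \<Rightarrow> nat \<Rightarrow> 'a" where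
  "lam m w c i u =
     (if i < m then
        (if w = 2 then c ^ (i * (w + 2) + u)
         else c ^ (i * (w + 1) + u))
      else
        (if w = 2 then c ^ ((i - m) * (w + 2) + w + u)
         else if u = 0 then c ^ ((i - m) * (w + 1) + w)
         else c ^ ((i - m) * (w + 1) + u mod (w - 1) + 1)))"

definition xelt :: "nat \<Rightarrow> nat \<Rightarrow> 'a::field \<Rightarrow> nat \<Rightarrow> 'a" where
  "xelt m w c i =
     (if w = 2 then c ^ ((i div (2 * m)) * m * (w + 2))
      else c ^ ((i div (2 * m)) * m * (w + 1)))"

end

(* Every product x_i * lam_{i mod nbar, u} is a power of c whose exponent, written in base
   k = w + 2 or w + 1, has last digit depending only on u and on the half of [0:2m) containing
   i mod 2m, while the leading part is (i div 2m) m + i mod m.  All these exponents lie below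
   s m k <= q - 1, where powers of the primitive element c are distinct, so an equality of products
   forces equal blocks i div 2m, equal residues mod m and equal last digits. *)
theory Submission
  imports Defs
begin

text \<open>If c^a = c^b with a < b, any exponent k >= b can be lowered by b - a without changing
  the power. Repeating this leaves at most b distinct powers, while a primitive element has
  \<open>CARD('a) - 1\<close> of them, so b cannot lie below that number.\<close>

lemma primitive_power_inj_on:
  fixes c :: "'a::{field,finite}"
  assumes "primitive_element c"
  shows "inj_on (\<lambda>k::nat. c ^ k) {..<CARD('a) - 1}"
proof -
  have distinct: "c ^ a \<noteq> c ^ b" if "a < b" "b < CARD('a) - 1" for a b :: nat
  proof
    assume eq: "c ^ a = c ^ b"
    have reduce: "c ^ k \<in> (\<lambda>k. c ^ k) ` {..<b}" for k
    proof (induction k rule: less_induct)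
      case (less k)
      show ?case
      proof (cases "k < b")
        case False
        then have "c ^ k = c ^ (k - b) * c ^ b"
          by (simp flip: power_add)
        also have "\<dots> = c ^ (k - b + a)"
          by (simp add: eq power_add)
        finally show ?thesis
          using less.IH[of "k - b + a"] False \<open>a < b\<close> by simp
      qed auto
    qed
    have "CARD('a) - 1 = card (range (\<lambda>k::nat. c ^ k))"
      using assms by (simp add: primitive_element_def card_Diff_singleton)
    also have "\<dots> \<le> card ((\<lambda>k. c ^ k) ` {..<b})"
      using reduce by (intro card_mono) auto
    also have "\<dots> \<le> b"
      using card_image_le[of "{..<b}" "\<lambda>k. c ^ k"] by simp
    finally show False
      using that by simp
  qed
  show ?thesis
    by (rule inj_onI) (metis distinct lessThan_iff linorder_neqE_nat)
qed

definition base :: "nat \<Rightarrow> nat" where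
  "base w = (if w = 2 then w + 2 else w + 1)"

text \<open>Here \<open>upper\<close> marks a first index of \<open>lam\<close> in [m, 2m). For w =
  2 the two halves use the digits {0, 1} and {2, 3}. For w >= 3 the upper half sends 0 to w and
  permutes 1, ..., w-1 by the cyclic shift 1 -> 2 -> ... -> w-1 -> 1.\<close>

definition digit :: "nat \<Rightarrow> bool \<Rightarrow> nat \<Rightarrow> nat" where
  "digit w upper u =
     (if \<not> upper then u
      else if w = 2 then w + u
      else if u = 0 then w
      else u mod (w - 1) + 1)"

lemma mod_pred_cases:
  fixes u w :: nat
  assumes "u < w"
  shows "u mod (w - 1) = (if u = w - 1 then 0 else u)"
  using assms by auto

lemma digit_less_base:
  assumes "2 \<le> w" "u < w"
  shows "digit w upper u < base w"
  using assms by (auto simp: digit_def base_def mod_pred_cases simp del: One_nat_def)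

text \<open>For w >= 3 the cyclic shift moves w-1 >= 2 elements and so has no fixed point, and 0
  goes to w. For w = 2 the halves have disjoint digits.\<close>

lemma digit_half_neq:
  assumes "2 \<le> w" "u < w"
  shows "digit w True u \<noteq> digit w False u"
  using assms by (auto simp: digit_def mod_pred_cases simp del: One_nat_def split: if_splits)

lemma digit_inj:
  assumes "2 \<le> w" "u < w" "u' < w" "digit w upper u = digit w upper u'"
  shows "u = u'"
  using assms by (auto simp: digit_def mod_pred_cases simp del: One_nat_def split: if_splits)

text \<open>In the lower half u = 0 has digit 0, and every upper digit is positive. In the upper
  half it has digit w, and every lower digit is below w.\<close>

lemma digit_zero_neq:
  assumes "2 \<le> w" "0 < u" "u < w"
  shows "digit w upper 0 \<noteq> digit w (\<not> upper) u"
  using assms by (auto simp: digit_def mod_pred_cases simp del: One_nat_def split: if_splits)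

lemma lam_eq_power:
  assumes "i < 2 * m"
  shows "lam m w c i u = c ^ ((i mod m) * base w + digit w (m \<le> i) u)"
proof -
  have "i mod m = (if i < m then i else i - m)"
    using assms by (simp add: mod_if)
  then show ?thesis
    by (auto simp: lam_def base_def digit_def add.assoc simp del: One_nat_def)
qed

definition code_exp :: "nat \<Rightarrow> nat \<Rightarrow> nat \<Rightarrow> nat \<Rightarrow> nat" where
  "code_exp m w i u = (i div (2 * m) * m + i mod m) * base w + digit w (m \<le> i mod (2 * m)) u"

lemma xelt_mult_lam:
  assumes "0 < m"
  shows "xelt m w c i * lam m w c (i mod (2 * m)) u = c ^ code_exp m w i u"
proof -
  have "i mod (2 * m) mod m = i mod m"
    by (simp add: mod_mod_cancel)
  then show ?thesis
    using assms
    by (simp add: lam_eq_power xelt_def code_exp_def base_def algebra_simps flip: power_add)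
qed

text \<open>The leading part is at most (s-1)m + (m-1) = sm - 1, which leaves one whole multiple of
  \<open>base w\<close> as room for the digit.\<close>

lemma code_exp_less:
  assumes "2 \<le> w" "u < w" "i < s * (2 * m)"
  shows "code_exp m w i u < s * m * base w"
proof -
  have m: "0 < m"
    using assms by (cases m) auto
  have "i div (2 * m) < s"
    using assms by (simp add: less_mult_imp_div_less)
  then have "Suc (i div (2 * m)) * m \<le> s * m"
    by (intro mult_right_mono) auto
  then have "Suc (i div (2 * m) * m + i mod m) \<le> s * m"
    using mod_less_divisor[OF m, of i] by simp
  then have "Suc (i div (2 * m) * m + i mod m) * base w \<le> s * m * base w"
    by (rule mult_right_mono) simp
  then show ?thesis
    using digit_less_base[OF assms(1,2), of "m \<le> i mod (2 * m)"] by (simp add: code_exp_def)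
qed

lemma mult_add_less_eqD:
  fixes k a b x y :: nat
  assumes "a * k + x = b * k + y" "x < k" "y < k"
  shows "a = b" "x = y"
proof -
  have "(a * k + x) div k = (b * k + y) div k" "(a * k + x) mod k = (b * k + y) mod k"
    by (simp_all only: assms(1))
  then show "a = b" "x = y"
    using assms(2,3) by simp_all
qed

text \<open>Two divisions with remainder decode the exponent: by \<open>base w\<close>, splitting
  off the digit, then by m, separating the block from the residue.\<close>

lemma code_exp_eqD:
  assumes "0 < m" "2 \<le> w" "u < w" "u' < w" "code_exp m w i u = code_exp m w j u'"
  shows "i div (2 * m) = j div (2 * m)" "i mod m = j mod m"
    "digit w (m \<le> i mod (2 * m)) u = digit w (m \<le> j mod (2 * m)) u'"
proof -
  note outer = mult_add_less_eqD[OF assms(5)[unfolded code_exp_def]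
      digit_less_base[OF assms(2,3)] digit_less_base[OF assms(2,4)]]
  note inner = mult_add_less_eqD[OF outer(1)
      mod_less_divisor[OF assms(1)] mod_less_divisor[OF assms(1)]]
  show "i div (2 * m) = j div (2 * m)" "i mod m = j mod m"
    "digit w (m \<le> i mod (2 * m)) u = digit w (m \<le> j mod (2 * m)) u'"
    using inner outer(2) by auto
qed

text \<open>The remainder modulo 2m is the remainder modulo m, increased by m exactly in the upper
  half.\<close>

lemma mod_double_eqI:
  fixes i j m :: nat
  assumes "i mod m = j mod m" "m \<le> i mod (2 * m) \<longleftrightarrow> m \<le> j mod (2 * m)"
  shows "i mod (2 * m) = j mod (2 * m)"
proof (cases "m = 0")
  case False
  have halves: "k mod (2 * m) = k mod m + (if m \<le> k mod (2 * m) then m else 0)" for k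
  proof -
    have "k mod (2 * m) < 2 * m"
      using False by simp
    moreover have "k mod m = k mod (2 * m) mod m"
      by (simp add: mod_mod_cancel)
    ultimately show ?thesis
      by (auto simp: le_mod_geq)
  qed
  show ?thesis
    using halves[of i] halves[of j] assms by simp
qed (use assms in simp)

theorem theorem4:
  fixes c :: "'a::{field,finite}"
    and m s w r nbar n q :: nat
  assumes "m \<ge> 2" and "s \<ge> 2"
    and "2 \<le> w" and "w < r" and "r < nbar"
    and "nbar = 2 * m" and "n = s * nbar"
    and "q = CARD('a)"
    and "primitive_element c"
    and "w = 2 \<Longrightarrow> q > s * m * (w + 2)"
    and "w \<in> {3..<r} \<Longrightarrow> q > s * m * (w + 1)"
  shows
    "(\<forall>u\<in>{0..<w}. \<forall>u'\<in>{0..<w}. \<forall>i\<in>{0..<n}. \<forall>j\<in>{0..<n}. \<not> [i = j] (mod m) \<longrightarrow>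
        xelt m w c i * lam m w c (i mod nbar) u \<noteq> xelt m w c j * lam m w c (j mod nbar) u') \<and>
     (\<forall>u\<in>{0..<w}. \<forall>i\<in>{0..<n}. \<forall>j\<in>{0..<n}. i \<noteq> j \<and> [i = j] (mod m) \<longrightarrow>
        xelt m w c i * lam m w c (i mod nbar) u \<noteq> xelt m w c j * lam m w c (j mod nbar) u) \<and>
     (\<forall>u\<in>{0..<w}. \<forall>u'\<in>{0..<w}. \<forall>i\<in>{0..<nbar}. u \<noteq> u' \<longrightarrow>
        lam m w c i u \<noteq> lam m w c i u') \<and>
     (\<forall>u\<in>{1..<w}. \<forall>i\<in>{0..<n}. \<forall>j\<in>{0..<n}. [i = j] (mod m) \<and> \<not> [i = j] (mod nbar) \<longrightarrow>
        xelt m w c i * lam m w c (i mod nbar) 0 \<noteq> xelt m w c j * lam m w c (j mod nbar) u)"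
proof -
  have m: "0 < m" and w: "2 \<le> w"
    using assms(1,3) by auto
  \<comment> \<open>The bound on q places all exponents in the range where powers of c are
    distinct.\<close>
  have q: "s * m * base w \<le> CARD('a) - 1"
    using assms(3,4,8,10,11) by (cases "w = 2") (auto simp: base_def)
  have exp_eq: "code_exp m w i u = code_exp m w j u'"
    if "u < w" "u' < w" "i < n" "j < n"
      "xelt m w c i * lam m w c (i mod nbar) u = xelt m w c j * lam m w c (j mod nbar) u'"
    for i j u u'
  proof -
    have "code_exp m w i u < CARD('a) - 1" "code_exp m w j u' < CARD('a) - 1"
      using that assms(6,7) q code_exp_less[OF w] by (meson less_le_trans)+
    moreover have "c ^ code_exp m w i u = c ^ code_exp m w j u'"
      using that(5) m by (simp add: assms(6) xelt_mult_lam)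
    ultimately show ?thesis
      using primitive_power_inj_on[OF assms(9)] by (simp add: inj_on_def)
  qed
  note eqD = code_exp_eqD[OF m w _ _ exp_eq]
  have i: "xelt m w c i * lam m w c (i mod nbar) u \<noteq> xelt m w c j * lam m w c (j mod nbar) u'"
    if "u < w" "u' < w" "i < n" "j < n" "\<not> [i = j] (mod m)" for i j u u'
    using that eqD(2)[of u u' i j] by (auto simp: cong_def)
  have ii: "xelt m w c i * lam m w c (i mod nbar) u \<noteq> xelt m w c j * lam m w c (j mod nbar) u"
    if "u < w" "i < n" "j < n" "i \<noteq> j" "[i = j] (mod m)" for i j u
  proof
    assume eq: "xelt m w c i * lam m w c (i mod nbar) u = xelt m w c j * lam m w c (j mod nbar) u"
    note D = eqD[OF that(1,1) that(1,1,2,3) eq]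
    \<comment> \<open>Both digits belong to the same u, so different halves would give different
      digits.\<close>
    have "m \<le> i mod (2 * m) \<longleftrightarrow> m \<le> j mod (2 * m)"
      using D(3) digit_half_neq[OF w that(1)] by metis
    then have "i mod (2 * m) = j mod (2 * m)"
      using D(2) by (rule mod_double_eqI[rotated])
    then show False
      using D(1) that(4) by (metis div_mult_mod_eq)
  qed
  have iii: "lam m w c i u \<noteq> lam m w c i u'"
    if "u < w" "u' < w" "i < nbar" "u \<noteq> u'" for i u u'
  proof
    assume eq: "lam m w c i u = lam m w c i u'"
    have "i < n"
      using that(3) assms(2,7) by (cases s) auto
    \<comment> \<open>Multiplying both sides by \<open>xelt m w c i\<close> gives an equality of
      products with j = i, to which the decoding applies.\<close>
    then have "digit w (m \<le> i mod (2 * m)) u = digit w (m \<le> i mod (2 * m)) u'"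
      using eqD(3)[of u u' i i] that eq by simp
    then show False
      using digit_inj[OF w that(1,2)] that(4) by blast
  qed
  have iv: "xelt m w c i * lam m w c (i mod nbar) 0 \<noteq> xelt m w c j * lam m w c (j mod nbar) u"
    if "0 < u" "u < w" "i < n" "j < n" "[i = j] (mod m)" "\<not> [i = j] (mod nbar)" for i j u
  proof
    assume eq: "xelt m w c i * lam m w c (i mod nbar) 0 = xelt m w c j * lam m w c (j mod nbar) u"
    have "0 < w"
      using w by simp
    note D = eqD(3)[OF this that(2) this that(2,3,4) eq]
    \<comment> \<open>Indices congruent modulo m but not modulo 2m lie in opposite halves.\<close>
    have "(m \<le> j mod (2 * m)) = (\<not> m \<le> i mod (2 * m))"
      using that(5,6) mod_double_eqI[of i m j] by (auto simp: cong_def assms(6))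
    then show False
      using D digit_zero_neq[OF w that(1,2), of "m \<le> i mod (2 * m)"] by (simp only:)
  qed
  show ?thesis
    using i ii iii iv by auto
qed

end
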